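(* Let $\alpha=[c_0,c_1,\ldots,c_r,\overline{c_{r+1},\ldots,c_{r+l}}]$ be a quadratic irrational with eventually periodic continued fraction ($r\ge0$, $l\ge1$) and matrices of convergents $\Psi_n$. Let $m\ge r+l$, $m_0=r+((m-r)\bmod l)$, and $m=m_0+lh$, with $h$ having the nested binary representation $$h=2^{m_1}(1+2^{m_2}(1+\cdots+2^{m_{q-1}}(1+2^{m_q}))),\qquad m_1\ge 0,\ m_i>0\ (1<i\le q).$$ Let $n_q=m_1+\cdots+m_q$, $k_0=1$, and $k_j=1+2^{m_{q+1-j}}k_{j-1}$ for $j=1,\ldots,q-1$. Then the nested binary additive algorithm (described in the context), which computes $\Psi_m$ from $\Psi_{r+l},\Psi_r,\Psi_{m_0}$ and coefficients $t_j$, uses $q+2$ matrix multiplications (only $q$ if $m_0=r$) and $\sum_{i=1}^q m_i=n_q$ linear combinations of matrices, and the coefficients that have to be determined are $$t_{k_{j-1}2^i},\qquad i=0,1,\ldots,m_{q+1-j}-1,\quad j=1,\ldots,q.$$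
   Context: The continued fraction is either the simple continued fraction of a real number (integer partial quotients) or a continued fraction of a complex number with Gaussian integer partial quotients (e.g. Hurwitz), with $c_{r+i}=c_{r+i+l}$ for all $i>0$. The matrix of convergents is $$\Psi_n=\begin{pmatrix} c_0 & 1 \\ 1 & 0 \end{pmatrix}\cdots\begin{pmatrix} c_n & 1 \\ 1 & 0 \end{pmatrix}=\begin{pmatrix} p_n & p_{n-1} \\ q_n & q_{n-1} \end{pmatrix}.$$ The scalars are $t_j=\mathrm{Tr}\left((\Psi_r^{-1}\Psi_{r+l})^j\right)$; equivalently $t_0=2$, $t_1=\mathrm{Tr}(\Psi_r^{-1}\Psi_{r+l})$, $t_{j+2}=t_1t_{j+1}-(-1)^lt_j$. Nested binary additive algorithm (the matrices $\Psi_{r+l},\Psi_r,\Psi_{m_0}$ are given): 1. If $m_0\ne r$, define $\Psi_{m_0+l}=\Psi_{r+l}\Psi_r^{-1}\Psi_{m_0}$. 2. Define $\Phi=\Psi_{m_0}^{-1}\Psi_{m_0+l}$. 3. For $j=0,\ldots,q-1$: (a) for $i=0,\ldots,m_{q-j}-1$ define $\Psi_{m_0+2^{i+1}k_jl}=t_{2^ik_j}\Psi_{m_0+2^ik_jl}-(-1)^{2^ik_jl}\Psi_{m_0}$; (b) if $j\ne q-1$ define $\Psi_{m_0+lk_{j+1}}=\Psi_{m_0+2^{m_{q-j}}lk_j}\Phi$. 4. Return $\Psi_m$. Cost convention: one counts products of two $2\times2$ matrices ("matrix multiplications") and expressions $aA+bB$ with scalars $a,b$ and $2\times 2$ matrices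 $A,B$ ("linear combinations"); inverting a $2\times2$ matrix of determinant $\pm1$ is not counted, nor is the bit complexity of the entries or the cost of computing the scalars $t_j$. *)

theory Defs
  imports "HOL-Analysis.Analysis"
begin

section \<open>Continued fractions and their matrices of convergents\<close>

type_synonym mat2 = "complex^2^2"

definition cf_factor :: "complex \<Rightarrow> mat2" where
  "cf_factor a = vector [vector [a, 1], vector [1, 0]]"

primrec conv_mat :: "(nat \<Rightarrow> complex) \<Rightarrow> nat \<Rightarrow> mat2" where
  "conv_mat c 0 = cf_factor (c 0)"
| "conv_mat c (Suc n) = conv_mat c n ** cf_factor (c (Suc n))"

definition conv_num :: "(nat \<Rightarrow> complex) \<Rightarrow> nat \<Rightarrow> complex" where
  "conv_num c n = conv_mat c n $ 1 $ 1"

definition conv_den :: "(nat \<Rightarrow> complex) \<Rightarrow> nat \<Rightarrow> complex" where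
  "conv_den c n = conv_mat c n $ 2 $ 1"

text \<open>The meaning of \<open>\<alpha> = [c\<^sub>0, c\<^sub>1, \<dots>]\<close>: the convergents tend to \<open>\<alpha>\<close>. Since division by zero
  yields zero in HOL, all but finitely many denominators are required to be nonzero.\<close>

definition cf_value :: "(nat \<Rightarrow> complex) \<Rightarrow> complex \<Rightarrow> bool" where
  "cf_value c \<alpha> \<longleftrightarrow> (\<forall>\<^sub>F n in sequentially. conv_den c n \<noteq> 0) \<and>
     (\<lambda>n. conv_num c n / conv_den c n) \<longlonglongrightarrow> \<alpha>"

definition simple_cf :: "(nat \<Rightarrow> complex) \<Rightarrow> complex \<Rightarrow> bool" where
  "simple_cf c \<alpha> \<longleftrightarrow> \<alpha> \<in> \<real> \<and> c 0 \<in> \<int> \<and> (\<forall>n\<ge>1. \<exists>a::int. a \<ge> 1 \<and> c n = of_int a) \<and> cf_value c \<alpha>"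

text \<open>No particular expansion algorithm (Hurwitz or other) is assumed in the Gaussian case.\<close>

definition gaussian_cf :: "(nat \<Rightarrow> complex) \<Rightarrow> complex \<Rightarrow> bool" where
  "gaussian_cf c \<alpha> \<longleftrightarrow> (\<forall>n. Re (c n) \<in> \<int> \<and> Im (c n) \<in> \<int>) \<and> cf_value c \<alpha>"

definition gaussian_rationals :: "complex set" where
  "gaussian_rationals = {z. Re z \<in> \<rat> \<and> Im z \<in> \<rat>}"

definition quadratic_irrational :: "complex set \<Rightarrow> complex \<Rightarrow> bool" where
  "quadratic_irrational K \<alpha> \<longleftrightarrow> \<alpha> \<notin> K \<and>
     (\<exists>a\<in>K. \<exists>b\<in>K. \<exists>d\<in>K. a \<noteq> 0 \<and> a * \<alpha>\<^sup>2 + b * \<alpha> + d = 0)"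

text \<open>The operators \<open>*\<close> and \<open>^\<close> act entrywise on vectors and matrices, hence the following.\<close>

primrec mat_power :: "mat2 \<Rightarrow> nat \<Rightarrow> mat2" where
  "mat_power A 0 = mat 1"
| "mat_power A (Suc n) = mat_power A n ** A"

definition cf_trace :: "(nat \<Rightarrow> complex) \<Rightarrow> nat \<Rightarrow> nat \<Rightarrow> nat \<Rightarrow> complex" where
  "cf_trace c r l j = trace (mat_power (matrix_inv (conv_mat c r) ** conv_mat c (r + l)) j)"


section \<open>Straight-line programs over matrices\<close>

text \<open>The algorithm is given as syntax, so that its operations can be counted. Variables are the
  symbols \<open>\<Psi>\<^sub>n\<close> and \<open>\<Phi>\<close>; scalars are a coefficient \<open>t\<^sub>j\<close> or an explicit integer;
  \<open>Lin a A b B\<close> stands for \<open>aA + bB\<close>.\<close>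

datatype var = Psi nat | Phi

datatype scalar = Coeff nat | Const int

datatype mexp = Var var | Inv mexp | Mul mexp mexp | Lin scalar mexp scalar mexp

type_synonym program = "(var \<times> mexp) list"

type_synonym store = "var \<Rightarrow> mat2 option"

primrec eval_scalar :: "(nat \<Rightarrow> complex option) \<Rightarrow> scalar \<Rightarrow> complex option" where
  "eval_scalar t (Coeff j) = t j"
| "eval_scalar t (Const z) = Some (of_int z)"

text \<open>Evaluation fails (with \<open>None\<close>) when an unassigned variable or an unavailable coefficient is
  read, and when the matrix to be inverted does not have determinant \<open>\<plusminus>1\<close>: only such inversions
  are free of charge.\<close>

primrec eval :: "(nat \<Rightarrow> complex option) \<Rightarrow> store \<Rightarrow> mexp \<Rightarrow> mat2 option" where
  "eval t s (Var x) = s x"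
| "eval t s (Inv e) =
     (case eval t s e of
        Some A \<Rightarrow> if det A = 1 \<or> det A = - 1 then Some (matrix_inv A) else None
      | None \<Rightarrow> None)"
| "eval t s (Mul e f) =
     (case (eval t s e, eval t s f) of
        (Some A, Some B) \<Rightarrow> Some (A ** B)
      | _ \<Rightarrow> None)"
| "eval t s (Lin a e b f) =
     (case (eval_scalar t a, eval t s e, eval_scalar t b, eval t s f) of
        (Some x, Some A, Some y, Some B) \<Rightarrow> Some (\<chi> i j. x * A $ i $ j + y * B $ i $ j)
      | _ \<Rightarrow> None)"

primrec run :: "(nat \<Rightarrow> complex option) \<Rightarrow> program \<Rightarrow> store \<Rightarrow> store option" where
  "run t [] s = Some s"
| "run t (stm # p) s =
     (case eval t s (snd stm) of
        Some A \<Rightarrow> run t p (s(fst stm \<mapsto> A))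
      | None \<Rightarrow> None)"

definition result :: "(nat \<Rightarrow> complex option) \<Rightarrow> program \<Rightarrow> store \<Rightarrow> var \<Rightarrow> mat2 option" where
  "result t p s x = (case run t p s of Some s' \<Rightarrow> s' x | None \<Rightarrow> None)"

primrec exp_mults :: "mexp \<Rightarrow> nat" where
  "exp_mults (Var x) = 0"
| "exp_mults (Inv e) = exp_mults e"
| "exp_mults (Mul e f) = exp_mults e + exp_mults f + 1"
| "exp_mults (Lin a e b f) = exp_mults e + exp_mults f"

primrec exp_lincombs :: "mexp \<Rightarrow> nat" where
  "exp_lincombs (Var x) = 0"
| "exp_lincombs (Inv e) = exp_lincombs e"
| "exp_lincombs (Mul e f) = exp_lincombs e + exp_lincombs f"
| "exp_lincombs (Lin a e b f) = exp_lincombs e + exp_lincombs f + 1"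

primrec scalar_coeffs :: "scalar \<Rightarrow> nat set" where
  "scalar_coeffs (Coeff j) = {j}"
| "scalar_coeffs (Const z) = {}"

primrec exp_coeffs :: "mexp \<Rightarrow> nat set" where
  "exp_coeffs (Var x) = {}"
| "exp_coeffs (Inv e) = exp_coeffs e"
| "exp_coeffs (Mul e f) = exp_coeffs e \<union> exp_coeffs f"
| "exp_coeffs (Lin a e b f) =
     scalar_coeffs a \<union> exp_coeffs e \<union> scalar_coeffs b \<union> exp_coeffs f"

definition mults :: "program \<Rightarrow> nat" where
  "mults p = (\<Sum>stm\<leftarrow>p. exp_mults (snd stm))"

definition lincombs :: "program \<Rightarrow> nat" where
  "lincombs p = (\<Sum>stm\<leftarrow>p. exp_lincombs (snd stm))"

definition coeff_indices :: "program \<Rightarrow> nat set" where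
  "coeff_indices p = (\<Union>stm\<in>set p. exp_coeffs (snd stm))"


section \<open>The nested binary additive algorithm\<close>

text \<open>\<open>nested_binary [m\<^sub>1, \<dots>, m\<^sub>q] = 2^m\<^sub>1 (1 + 2^m\<^sub>2 (1 + \<dots> (1 + 2^m\<^sub>q)))\<close> for \<open>q \<ge> 1\<close>; the value at
  the empty list makes the innermost factor \<open>2^m\<^sub>q\<close> come out right.\<close>

primrec nested_binary :: "nat list \<Rightarrow> nat" where
  "nested_binary [] = 0"
| "nested_binary (a # as) = 2 ^ a * (1 + nested_binary as)"

text \<open>Here and below the exponents are a function \<open>e\<close> with \<open>e i = m\<^sub>i\<close> for \<open>1 \<le> i \<le> q\<close>.
  In the recursion, \<open>q - j\<close> is \<open>q + 1 - Suc j\<close>.\<close>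

primrec nested_k :: "nat \<Rightarrow> (nat \<Rightarrow> nat) \<Rightarrow> nat \<Rightarrow> nat" where
  "nested_k q e 0 = 1"
| "nested_k q e (Suc j) = 1 + 2 ^ e (q - j) * nested_k q e j"

definition nested_binary_additive ::
  "nat \<Rightarrow> nat \<Rightarrow> nat \<Rightarrow> nat \<Rightarrow> (nat \<Rightarrow> nat) \<Rightarrow> program" where
  "nested_binary_additive r l m\<^sub>0 q e =
     (let k = nested_k q e; \<Psi> = (\<lambda>n. Var (Psi n)) in
        (if m\<^sub>0 \<noteq> r then [(Psi (m\<^sub>0 + l), Mul (Mul (\<Psi> (r + l)) (Inv (\<Psi> r))) (\<Psi> m\<^sub>0))] else [])
      @ [(Phi, Mul (Inv (\<Psi> m\<^sub>0)) (\<Psi> (m\<^sub>0 + l)))]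
      @ concat (map (\<lambda>j.
            map (\<lambda>i. (Psi (m\<^sub>0 + 2 ^ (i + 1) * k j * l),
                       Lin (Coeff (2 ^ i * k j)) (\<Psi> (m\<^sub>0 + 2 ^ i * k j * l))
                           (Const (- ((- 1) ^ (2 ^ i * k j * l)))) (\<Psi> m\<^sub>0)))
                [0..<e (q - j)]
          @ (if j \<noteq> q - 1
             then [(Psi (m\<^sub>0 + l * k (j + 1)),
                    Mul (\<Psi> (m\<^sub>0 + 2 ^ e (q - j) * l * k j)) (Var Phi))]
             else []))
          [0..<q]))"

end

theory Submission
  imports Defs
begin

text \<open>Put \<open>P = \<Psi>\<^sub>r\<^sub>+\<^sub>l \<Psi>\<^sub>r\<^sup>-\<^sup>1\<close>. Periodicity gives \<open>\<Psi>\<^sub>n\<^sub>+\<^sub>j\<^sub>l = P\<^sup>j \<Psi>\<^sub>n\<close> for all \<open>n \<ge> r\<close>. The matrix \<open>P\<close> has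
  determinant \<open>(-1)\<^sup>l\<close> and is conjugate to \<open>\<Psi>\<^sub>r\<^sup>-\<^sup>1 \<Psi>\<^sub>r\<^sub>+\<^sub>l\<close>, so that the trace of \<open>P\<^sup>j\<close> is \<open>t\<^sub>j\<close>.
  Hence the doubling steps are the Cayley--Hamilton theorem for \<open>P\<^sup>j\<close> multiplied by \<open>\<Psi>\<^sub>m\<^sub>0\<close>, and
  right multiplication by \<open>\<Phi> = \<Psi>\<^sub>m\<^sub>0\<^sup>-\<^sup>1 P \<Psi>\<^sub>m\<^sub>0\<close> increases the exponent of \<open>P\<close> by one.\<close>

section \<open>Inverses, powers and traces of two-by-two matrices\<close>

lemma matrix_inv_det_nz:
  fixes A :: mat2
  assumes "det A \<noteq> 0"
  shows matrix_inv_right_det_nz: "A ** matrix_inv A = mat 1"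
    and matrix_inv_left_det_nz: "matrix_inv A ** A = mat 1"
proof -
  have "\<exists>B. A ** B = mat 1 \<and> B ** A = mat 1"
    using assms invertible_det_nz[of A] by (simp add: invertible_def)
  then have "A ** matrix_inv A = mat 1 \<and> matrix_inv A ** A = mat 1"
    unfolding matrix_inv_def by (rule someI_ex)
  then show "A ** matrix_inv A = mat 1" "matrix_inv A ** A = mat 1"
    by auto
qed

text \<open>Cayley--Hamilton multiplied on the right by \<open>B\<close>, checked entry by entry.
  The factor \<open>B\<close> is carried along because the identity is needed for \<open>A\<close> a
  power of the period matrix and \<open>B\<close> a matrix of convergents.\<close>

lemma Cayley_Hamilton_2_mult:
  fixes A B :: mat2
  shows "(A ** A ** B) $ i $ j = trace A * (A ** B) $ i $ j - det A * B $ i $ j"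
proof -
  have "\<forall>i j. (A ** A ** B) $ i $ j = trace A * (A ** B) $ i $ j - det A * B $ i $ j"
    by (simp add: forall_2 matrix_matrix_mult_def sum_2 det_2 trace_def algebra_simps)
  then show ?thesis by blast
qed

lemma mat_power_add: "mat_power A (m + n) = mat_power A m ** mat_power A n"
  by (induction n) (simp_all add: matrix_mul_assoc)

lemma det_mat_power: "det (mat_power A n) = det A ^ n"
  by (induction n) (simp_all add: det_mul mult.commute)

lemma mat_power_mult_swap: "mat_power (B ** A) n ** B = B ** mat_power (A ** B) n"
proof (induction n)
  case (Suc n)
  have "mat_power (B ** A) (Suc n) ** B = (mat_power (B ** A) n ** B) ** (A ** B)"
    by (simp add: matrix_mul_assoc)
  then show ?case
    by (simp add: Suc matrix_mul_assoc)
qed simp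

text \<open>Since AB = B^-1 (BA) B, the n-th powers of AB and BA are conjugate by B as well, and
  conjugate matrices have equal trace.\<close>

lemma trace_conjugate:
  fixes A B :: mat2
  assumes "det B \<noteq> 0"
  shows "trace (mat_power (A ** B) n) = trace (mat_power (B ** A) n)"
proof -
  have "mat_power (A ** B) n = matrix_inv B ** (mat_power (B ** A) n ** B)"
    by (simp add: mat_power_mult_swap matrix_mul_assoc matrix_inv_left_det_nz[OF assms])
  also have "trace \<dots> = trace (mat_power (B ** A) n ** B ** matrix_inv B)"
    by (rule trace_mul_sym)
  also have "\<dots> = trace (mat_power (B ** A) n)"
    by (simp add: matrix_inv_right_det_nz[OF assms] flip: matrix_mul_assoc)
  finally show ?thesis .
qed

section \<open>Determinants and periodicity of the matrices of convergents\<close>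

lemma det_cf_factor: "det (cf_factor a) = - 1"
  by (simp add: cf_factor_def det_2)

lemma det_conv_mat: "det (conv_mat c n) = (- 1) ^ Suc n"
  by (induction n) (simp_all add: det_mul det_cf_factor)

lemma det_conv_mat_nz: "det (conv_mat c n) \<noteq> 0"
  by (simp add: det_conv_mat)

lemma det_conv_mat_cases: "det (conv_mat c n) = 1 \<or> det (conv_mat c n) = - 1"
  unfolding det_conv_mat by (metis minus_one_power_iff)

text \<open>This is the matrix P of the overview. Acting from the left, one matrix serves every
  index from \<open>r\<close> on; the right factor \<open>\<Phi>\<close> that performs the same
  shift depends on the index.\<close>

definition period_mat :: "(nat \<Rightarrow> complex) \<Rightarrow> nat \<Rightarrow> nat \<Rightarrow> mat2" where
  "period_mat c r l = conv_mat c (r + l) ** matrix_inv (conv_mat c r)"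

lemma det_period_mat: "det (period_mat c r l) = (- 1) ^ l"
proof -
  \<comment> \<open>Clearing the inverse first makes multiplicativity of the determinant
    suffice.\<close>
  have "period_mat c r l ** conv_mat c r = conv_mat c (r + l)"
    by (simp add: period_mat_def matrix_inv_left_det_nz[OF det_conv_mat_nz] flip: matrix_mul_assoc)
  then have "det (period_mat c r l) * det (conv_mat c r) = det (conv_mat c (r + l))"
    by (simp flip: det_mul)
  then show ?thesis
    by (simp add: det_conv_mat power_add)
qed

lemma cf_trace_eq: "cf_trace c r l j = trace (mat_power (period_mat c r l) j)"
  unfolding cf_trace_def period_mat_def by (rule trace_conjugate) (rule det_conv_mat_nz)

text \<open>At the index \<open>r\<close> this is the definition of P. Passing from \<open>n\<close>
  to \<open>Suc n\<close> multiplies both sides on the right by the same factor, because the partial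
  quotients at \<open>Suc n\<close> and \<open>Suc n + l\<close> agree.\<close>

lemma conv_mat_add_period:
  assumes per: "\<forall>i>0. c (r + i) = c (r + i + l)" and "n \<ge> r"
  shows "conv_mat c (n + l) = period_mat c r l ** conv_mat c n"
  using \<open>n \<ge> r\<close>
proof (induction n rule: dec_induct)
  case base
  show ?case
    by (simp add: period_mat_def matrix_inv_left_det_nz[OF det_conv_mat_nz] flip: matrix_mul_assoc)
next
  case (step n)
  have "c (Suc n) = c (Suc n + l)"
    using per[rule_format, of "Suc n - r"] step.hyps by simp
  then show ?case
    by (simp add: step.IH matrix_mul_assoc)
qed

lemma conv_mat_add_periods:
  assumes "\<forall>i>0. c (r + i) = c (r + i + l)" and "n \<ge> r"
  shows "conv_mat c (n + j * l) = mat_power (period_mat c r l) j ** conv_mat c n"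
proof (induction j)
  case (Suc j)
  have "conv_mat c (n + Suc j * l) = period_mat c r l ** conv_mat c (n + j * l)"
    using conv_mat_add_period[of c r l "n + j * l"] assms by (simp add: algebra_simps)
  \<comment> \<open>The exponent is written \<open>1 + j\<close> because the new factor P stands on
    the left, while \<open>mat_power\<close> appends factors on the right.\<close>
  also have "\<dots> = mat_power (period_mat c r l) (1 + j) ** conv_mat c n"
    unfolding mat_power_add Suc by (simp add: matrix_mul_assoc)
  finally show ?case by simp
qed simp

text \<open>Cayley--Hamilton for P^j, whose trace is \<open>t\<^sub>j\<close> and whose determinant
  is (-1)^(jl). The right-hand side has the entrywise form that \<open>eval\<close> produces for
  \<open>Lin\<close>.\<close>

lemma conv_mat_doubling:
  assumes "\<forall>i>0. c (r + i) = c (r + i + l)" and "n \<ge> r"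
  shows "conv_mat c (n + 2 * j * l) =
    (\<chi> i i'. cf_trace c r l j * conv_mat c (n + j * l) $ i $ i' +
      - ((- 1) ^ (j * l)) * conv_mat c n $ i $ i')"
proof -
  let ?A = "mat_power (period_mat c r l) j"
  have "det ?A = (- 1) ^ (j * l)"
    by (simp add: det_mat_power det_period_mat mult.commute flip: power_mult)
  moreover have "conv_mat c (n + 2 * j * l) = ?A ** ?A ** conv_mat c n"
    unfolding mat_power_add[symmetric] mult_2 by (rule conv_mat_add_periods[OF assms])
  ultimately show ?thesis
    using Cayley_Hamilton_2_mult[of ?A "conv_mat c n"]
    by (simp add: vec_eq_iff cf_trace_eq conv_mat_add_periods[OF assms, of j])
qed

text \<open>The first two factors multiply to P^j, which then acts on
  \<open>conv_mat c (n + l)\<close>. For n = \<open>m\<^sub>0\<close> the bracket is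
  \<open>\<Phi>\<close>, so this justifies the step between two rounds of doublings.\<close>

lemma conv_mat_shift_step:
  assumes "\<forall>i>0. c (r + i) = c (r + i + l)" and "n \<ge> r"
  shows "conv_mat c (n + j * l) ** (matrix_inv (conv_mat c n) ** conv_mat c (n + l)) =
    conv_mat c (n + Suc j * l)"
proof -
  have "conv_mat c (n + j * l) ** matrix_inv (conv_mat c n) = mat_power (period_mat c r l) j"
    by (simp add: conv_mat_add_periods[OF assms] matrix_inv_right_det_nz[OF det_conv_mat_nz]
        flip: matrix_mul_assoc)
  moreover have "conv_mat c (n + Suc j * l) =
      mat_power (period_mat c r l) j ** conv_mat c (n + l)"
    by (simp only: conv_mat_add_periods[OF assms] conv_mat_add_period[OF assms]
        mat_power.simps matrix_mul_assoc)
  ultimately show ?thesis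
    by (metis matrix_mul_assoc)
qed

section \<open>Running and counting concatenated programs\<close>

lemma run_append: "run t (p @ p') s = Option.bind (run t p s) (run t p')"
  by (induction p arbitrary: s) (simp_all split: option.split)

lemma
  shows mults_append: "mults (p @ p') = mults p + mults p'"
    and lincombs_append: "lincombs (p @ p') = lincombs p + lincombs p'"
    and coeff_indices_append: "coeff_indices (p @ p') = coeff_indices p \<union> coeff_indices p'"
  by (simp_all add: mults_def lincombs_def coeff_indices_def)

lemma
  shows mults_Nil: "mults [] = 0"
    and lincombs_Nil: "lincombs [] = 0"
    and coeff_indices_Nil: "coeff_indices [] = {}"
  by (simp_all add: mults_def lincombs_def coeff_indices_def)

lemma mults_concat_upt: "mults (concat (map f [0..<n])) = (\<Sum>j<n. mults (f j))"
  by (induction n) (simp_all add: mults_append mults_Nil)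

lemma lincombs_concat_upt: "lincombs (concat (map f [0..<n])) = (\<Sum>j<n. lincombs (f j))"
  by (induction n) (simp_all add: lincombs_append lincombs_Nil)

lemma coeff_indices_concat_upt:
  "coeff_indices (concat (map f [0..<n])) = (\<Union>j<n. coeff_indices (f j))"
  by (auto simp: coeff_indices_def)

section \<open>The algorithm cut into stages, its costs and its index arithmetic\<close>

definition doublings :: "nat \<Rightarrow> nat \<Rightarrow> nat \<Rightarrow> nat \<Rightarrow> program" where
  "doublings l m\<^sub>0 k n = map (\<lambda>i. (Psi (m\<^sub>0 + 2 ^ (i + 1) * k * l),
      Lin (Coeff (2 ^ i * k)) (Var (Psi (m\<^sub>0 + 2 ^ i * k * l)))
        (Const (- ((- 1) ^ (2 ^ i * k * l)))) (Var (Psi m\<^sub>0)))) [0..<n]"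

definition increment :: "nat \<Rightarrow> nat \<Rightarrow> nat \<Rightarrow> (nat \<Rightarrow> nat) \<Rightarrow> nat \<Rightarrow> program" where
  "increment l m\<^sub>0 q e j = (if j \<noteq> q - 1
      then [(Psi (m\<^sub>0 + l * nested_k q e (j + 1)),
        Mul (Var (Psi (m\<^sub>0 + 2 ^ e (q - j) * l * nested_k q e j))) (Var Phi))]
      else [])"

definition stage :: "nat \<Rightarrow> nat \<Rightarrow> nat \<Rightarrow> (nat \<Rightarrow> nat) \<Rightarrow> nat \<Rightarrow> program" where
  "stage l m\<^sub>0 q e j = doublings l m\<^sub>0 (nested_k q e j) (e (q - j)) @ increment l m\<^sub>0 q e j"

definition preamble :: "nat \<Rightarrow> nat \<Rightarrow> nat \<Rightarrow> program" where
  "preamble r l m\<^sub>0 =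
     (if m\<^sub>0 \<noteq> r
      then [(Psi (m\<^sub>0 + l), Mul (Mul (Var (Psi (r + l))) (Inv (Var (Psi r)))) (Var (Psi m\<^sub>0)))]
      else [])
     @ [(Phi, Mul (Inv (Var (Psi m\<^sub>0))) (Var (Psi (m\<^sub>0 + l))))]"

lemma nested_binary_additive_eq:
  "nested_binary_additive r l m\<^sub>0 q e =
     preamble r l m\<^sub>0 @ concat (map (stage l m\<^sub>0 q e) [0..<q])"
  unfolding nested_binary_additive_def preamble_def stage_def doublings_def increment_def Let_def
  by simp

lemma
  shows mults_doublings: "mults (doublings l m\<^sub>0 k n) = 0"
    and lincombs_doublings: "lincombs (doublings l m\<^sub>0 k n) = n"
    and coeff_indices_doublings: "coeff_indices (doublings l m\<^sub>0 k n) = (\<lambda>i. k * 2 ^ i) ` {..<n}"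
  by (auto simp: mults_def lincombs_def coeff_indices_def doublings_def comp_def sum_list_triv
      mult.commute)

text \<open>Each stage but the last has one multiplication, and computing \<open>\<Phi>\<close>
  takes one more, which gives q. For \<open>m\<^sub>0\<close> different from \<open>r\<close>, the
  matrix at \<open>m\<^sub>0 + l\<close> adds two.\<close>

lemma mults_nested_binary_additive:
  assumes "q \<ge> 1"
  shows "mults (nested_binary_additive r l m\<^sub>0 q e) = (if m\<^sub>0 = r then q else q + 2)"
proof -
  have "mults (stage l m\<^sub>0 q e j) = (if j \<noteq> q - 1 then 1 else 0)" for j
    unfolding stage_def mults_append mults_doublings by (simp add: mults_def increment_def)
  then have "(\<Sum>j<q. mults (stage l m\<^sub>0 q e j)) = card {j. j < q \<and> j \<noteq> q - 1}"
    by (simp add: sum.If_cases lessThan_def Collect_conj_eq[symmetric])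
  also have "{j. j < q \<and> j \<noteq> q - 1} = {..<q - 1}"
    by auto
  finally show ?thesis
    using assms by (simp add: nested_binary_additive_eq mults_append mults_concat_upt)
      (simp add: mults_def preamble_def)
qed

lemma lincombs_nested_binary_additive:
  "lincombs (nested_binary_additive r l m\<^sub>0 q e) = (\<Sum>i=1..q. e i)"
proof -
  have "lincombs (stage l m\<^sub>0 q e j) = e (q - j)" for j
    unfolding stage_def lincombs_append lincombs_doublings by (simp add: lincombs_def increment_def)
  moreover have "(\<Sum>j<q. e (q - j)) = (\<Sum>i=1..q. e i)"
    by (rule sum.reindex_bij_witness[of _ "\<lambda>i. q - i" "\<lambda>j. q - j"]) auto
  moreover have "lincombs (preamble r l m\<^sub>0) = 0"
    by (simp add: lincombs_def preamble_def)
  ultimately show ?thesis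
    by (simp add: nested_binary_additive_eq lincombs_append lincombs_concat_upt)
qed

text \<open>Stage j of the program, counted from 0, contributes the indices listed under j + 1 on
  the right.\<close>

lemma coeff_indices_nested_binary_additive:
  "coeff_indices (nested_binary_additive r l m\<^sub>0 q e) =
     {nested_k q e (j - 1) * 2 ^ i | i j. j \<in> {1..q} \<and> i < e (q + 1 - j)}"
proof -
  have "coeff_indices (stage l m\<^sub>0 q e j) = (\<lambda>i. nested_k q e j * 2 ^ i) ` {..<e (q - j)}" for j
    unfolding stage_def coeff_indices_append coeff_indices_doublings
    by (simp add: coeff_indices_def increment_def)
  moreover have "coeff_indices (preamble r l m\<^sub>0) = {}"
    by (simp add: coeff_indices_def preamble_def)
  ultimately have "coeff_indices (nested_binary_additive r l m\<^sub>0 q e) =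
      (\<Union>j<q. (\<lambda>i. nested_k q e j * 2 ^ i) ` {..<e (q - j)})"
    by (simp add: nested_binary_additive_eq coeff_indices_append coeff_indices_concat_upt)
  also have "\<dots> = (\<Union>j\<in>{1..q}. (\<lambda>i. nested_k q e (j - 1) * 2 ^ i) ` {..<e (q + 1 - j)})"
    unfolding image_Suc_lessThan[symmetric] by simp
  also have "\<dots> = {nested_k q e (j - 1) * 2 ^ i | i j. j \<in> {1..q} \<and> i < e (q + 1 - j)}"
    by blast
  finally show ?thesis .
qed

text \<open>The recursion for k evaluates the nested representation from the inside outwards,
  starting with the last exponent. At j = q - 1 all exponents are used up, and the value is
  h.\<close>

lemma nested_binary_eq_nested_k:
  assumes "j < q"
  shows "nested_binary (map e [q - j..<q + 1]) = 2 ^ e (q - j) * nested_k q e j"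
  using assms
proof (induction j)
  case (Suc j)
  then have "[q - Suc j..<q + 1] = (q - Suc j) # [q - j..<q + 1]"
    by (simp add: upt_conv_Cons Suc_diff_Suc del: upt_Suc)
  then show ?case
    using Suc by simp
qed simp

section \<open>Correctness of the computed matrix\<close>

definition stored :: "(nat \<Rightarrow> complex) \<Rightarrow> store \<Rightarrow> nat \<Rightarrow> bool" where
  "stored c s n \<longleftrightarrow> s (Psi n) = Some (conv_mat c n)"

text \<open>Writing a correct value cannot spoil a correct entry, even when the two indices
  coincide. So the indices written by the program need not be shown distinct.\<close>

lemma stored_update: "stored c (s(Psi n \<mapsto> conv_mat c n)) n' \<longleftrightarrow> n' = n \<or> stored c s n'"
  by (auto simp: stored_def)

text \<open>Induction on the number of doublings, with \<open>conv_mat_doubling\<close> for each.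
  The entries at \<open>m\<^sub>0\<close> and \<open>Phi\<close> belong to the invariant because
  later steps read them.\<close>

lemma run_doublings:
  assumes per: "\<forall>i>0. c (r + i) = c (r + i + l)" and "m\<^sub>0 \<ge> r"
    and "stored c s m\<^sub>0" and "stored c s (m\<^sub>0 + k * l)"
    and "\<And>i. i < n \<Longrightarrow> t (k * 2 ^ i) = Some (cf_trace c r l (k * 2 ^ i))"
  shows "\<exists>s'. run t (doublings l m\<^sub>0 k n) s = Some s' \<and> s' Phi = s Phi \<and>
    stored c s' m\<^sub>0 \<and> stored c s' (m\<^sub>0 + 2 ^ n * k * l)"
  using assms(5)
proof (induction n)
  case 0
  then show ?case
    using assms(3,4) by (simp add: doublings_def)
next
  case (Suc n)
  then obtain s' where s': "run t (doublings l m\<^sub>0 k n) s = Some s'" "s' Phi = s Phi"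
      "stored c s' m\<^sub>0" "stored c s' (m\<^sub>0 + 2 ^ n * k * l)"
    by auto
  have "t (2 ^ n * k) = Some (cf_trace c r l (2 ^ n * k))"
    using Suc.prems[of n] by (simp add: mult.commute)
  then have "eval t s' (Lin (Coeff (2 ^ n * k)) (Var (Psi (m\<^sub>0 + 2 ^ n * k * l)))
      (Const (- ((- 1) ^ (2 ^ n * k * l)))) (Var (Psi m\<^sub>0))) =
      Some (conv_mat c (m\<^sub>0 + 2 * (2 ^ n * k) * l))"
    using s'(3,4) unfolding stored_def
      conv_mat_doubling[OF per \<open>m\<^sub>0 \<ge> r\<close>, of "2 ^ n * k"] by simp
  moreover have "m\<^sub>0 + 2 ^ (n + 1) * k * l = m\<^sub>0 + 2 * (2 ^ n * k) * l"
    by simp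
  ultimately have "run t (doublings l m\<^sub>0 k (Suc n)) s =
      Some (s'(Psi (m\<^sub>0 + 2 ^ Suc n * k * l) \<mapsto> conv_mat c (m\<^sub>0 + 2 ^ Suc n * k * l)))"
    using s'(1) by (simp add: doublings_def run_append mult.assoc)
  then show ?case
    using s'(2,3) by (simp add: stored_update)
qed

text \<open>The invariant describes the store on entry to stage \<open>j\<close>. The bound
  \<open>j < q\<close> means that only stages ending with a multiplication by \<open>\<Phi>\<close>
  have been run.\<close>

lemma run_stages:
  assumes per: "\<forall>i>0. c (r + i) = c (r + i + l)" and "m\<^sub>0 \<ge> r"
    and s: "stored c s m\<^sub>0" "stored c s (m\<^sub>0 + l)"
      "s Phi = Some (matrix_inv (conv_mat c m\<^sub>0) ** conv_mat c (m\<^sub>0 + l))"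
    and t: "\<And>i j. j < q \<Longrightarrow> i < e (q - j) \<Longrightarrow>
      t (nested_k q e j * 2 ^ i) = Some (cf_trace c r l (nested_k q e j * 2 ^ i))"
    and "j < q"
  shows "\<exists>s'. run t (concat (map (stage l m\<^sub>0 q e) [0..<j])) s = Some s' \<and> s' Phi = s Phi \<and>
    stored c s' m\<^sub>0 \<and> stored c s' (m\<^sub>0 + nested_k q e j * l)"
  using \<open>j < q\<close>
proof (induction j)
  case 0
  then show ?case
    using s by simp
next
  case (Suc j)
  then obtain s1 where s1: "run t (concat (map (stage l m\<^sub>0 q e) [0..<j])) s = Some s1"
      "s1 Phi = s Phi" "stored c s1 m\<^sub>0" "stored c s1 (m\<^sub>0 + nested_k q e j * l)"
    by auto
  let ?d = "2 ^ e (q - j) * nested_k q e j"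
  obtain s2 where s2: "run t (doublings l m\<^sub>0 (nested_k q e j) (e (q - j))) s1 = Some s2"
      "s2 Phi = s Phi" "stored c s2 m\<^sub>0" "stored c s2 (m\<^sub>0 + ?d * l)"
    using run_doublings[OF per \<open>m\<^sub>0 \<ge> r\<close> s1(3,4), of "e (q - j)" t] t Suc.prems s1(2) by auto
  have idx: "m\<^sub>0 + 2 ^ e (q - j) * l * nested_k q e j = m\<^sub>0 + ?d * l"
    by simp
  \<comment> \<open>As \<open>Suc j < q\<close>, the guard of \<open>increment\<close> holds, and k
    at \<open>Suc j\<close> is \<open>Suc ?d\<close> by the recursion.\<close>
  have inc: "increment l m\<^sub>0 q e j =
      [(Psi (m\<^sub>0 + Suc ?d * l), Mul (Var (Psi (m\<^sub>0 + ?d * l))) (Var Phi))]"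
    using Suc.prems unfolding increment_def idx by (simp add: algebra_simps)
  have "run t (increment l m\<^sub>0 q e j) s2 =
      Some (s2(Psi (m\<^sub>0 + Suc ?d * l) \<mapsto> conv_mat c (m\<^sub>0 + Suc ?d * l)))"
    using s2(2,4) s(3) unfolding inc stored_def
      conv_mat_shift_step[OF per \<open>m\<^sub>0 \<ge> r\<close>, of ?d, symmetric] by simp
  then show ?case
    using s1(1) s2(1-3) by (simp add: run_append stage_def[of _ _ _ _ j] stored_update)
qed

text \<open>If \<open>m\<^sub>0 = r\<close>, the matrix at \<open>m\<^sub>0 + l\<close> is already
  an input. Otherwise the first assignment is P applied to the matrix at \<open>m\<^sub>0\<close>.
  The inversions succeed because matrices of convergents have determinant 1 or -1.\<close>

lemma run_preamble:
  assumes per: "\<forall>i>0. c (r + i) = c (r + i + l)" and "m\<^sub>0 \<ge> r"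
    and s: "stored c s r" "stored c s (r + l)" "stored c s m\<^sub>0"
  shows "\<exists>s'. run t (preamble r l m\<^sub>0) s = Some s' \<and> stored c s' m\<^sub>0 \<and> stored c s' (m\<^sub>0 + l) \<and>
    s' Phi = Some (matrix_inv (conv_mat c m\<^sub>0) ** conv_mat c (m\<^sub>0 + l))"
proof (cases "m\<^sub>0 = r")
  case True
  then show ?thesis
    using s det_conv_mat_cases[of c r] by (auto simp: preamble_def stored_def)
next
  case False
  let ?s = "s(Psi (m\<^sub>0 + l) \<mapsto> conv_mat c (m\<^sub>0 + l))"
  have "eval t s (Mul (Mul (Var (Psi (r + l))) (Inv (Var (Psi r)))) (Var (Psi m\<^sub>0))) =
      Some (conv_mat c (m\<^sub>0 + l))"
    using s det_conv_mat_cases[of c r]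
    by (auto simp: stored_def conv_mat_add_period[OF per \<open>m\<^sub>0 \<ge> r\<close>] period_mat_def)
  moreover have "stored c ?s m\<^sub>0" "stored c ?s (m\<^sub>0 + l)"
    using s(3) by (simp_all add: stored_update)
  ultimately show ?thesis
    using False det_conv_mat_cases[of c m\<^sub>0] unfolding preamble_def stored_def
    by (auto simp del: fun_upd_apply simp: fun_upd_same fun_upd_other)
qed

lemma result_nested_binary_additive:
  assumes per: "\<forall>i>0. c (r + i) = c (r + i + l)" and "m\<^sub>0 \<ge> r" and "q \<ge> 1"
    and s: "stored c s r" "stored c s (r + l)" "stored c s m\<^sub>0"
    and t: "\<And>i j. j < q \<Longrightarrow> i < e (q - j) \<Longrightarrow>
      t (nested_k q e j * 2 ^ i) = Some (cf_trace c r l (nested_k q e j * 2 ^ i))"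
    and n: "n = m\<^sub>0 + l * nested_binary (map e [1..<q + 1])"
  shows "result t (nested_binary_additive r l m\<^sub>0 q e) s (Psi n) = Some (conv_mat c n)"
proof -
  obtain s1 where s1: "run t (preamble r l m\<^sub>0) s = Some s1" "stored c s1 m\<^sub>0" "stored c s1 (m\<^sub>0 + l)"
      "s1 Phi = Some (matrix_inv (conv_mat c m\<^sub>0) ** conv_mat c (m\<^sub>0 + l))"
    using run_preamble[OF per \<open>m\<^sub>0 \<ge> r\<close> s] by blast
  \<comment> \<open>The last stage is treated apart, since it consists of doublings alone.\<close>
  let ?j = "q - 1" and ?k = "nested_k q e (q - 1)"
  obtain s2 where s2: "run t (concat (map (stage l m\<^sub>0 q e) [0..<?j])) s1 = Some s2"
      "stored c s2 m\<^sub>0" "stored c s2 (m\<^sub>0 + ?k * l)"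
    using run_stages[where t = t and j = ?j, OF per \<open>m\<^sub>0 \<ge> r\<close> s1(2-4) t] \<open>q \<ge> 1\<close> by auto
  have "q - ?j = 1"
    using \<open>q \<ge> 1\<close> by simp
  then obtain s3 where s3: "run t (doublings l m\<^sub>0 ?k (e 1)) s2 = Some s3"
      "stored c s3 (m\<^sub>0 + 2 ^ e 1 * ?k * l)"
    using run_doublings[where t = t and n = "e 1", OF per \<open>m\<^sub>0 \<ge> r\<close> s2(2,3)] t[of ?j] \<open>q \<ge> 1\<close>
    by auto
  have "n = m\<^sub>0 + 2 ^ e 1 * ?k * l"
    using nested_binary_eq_nested_k[of ?j q e] \<open>q - ?j = 1\<close> \<open>q \<ge> 1\<close> by (simp add: n)
  moreover have "[0..<q] = [0..<?j] @ [?j]"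
    using \<open>q \<ge> 1\<close> upt_Suc_append[of 0 ?j] by simp
  moreover have "stage l m\<^sub>0 q e ?j = doublings l m\<^sub>0 ?k (e 1)"
    using \<open>q - ?j = 1\<close> by (simp add: stage_def increment_def)
  ultimately show ?thesis
    using s1(1) s2(1) s3
    by (simp add: result_def nested_binary_additive_eq run_append stored_def)
qed

theorem proposition3p4:
  fixes c :: "nat \<Rightarrow> complex" and \<alpha> :: complex
    and r l m m\<^sub>0 h q :: nat and e :: "nat \<Rightarrow> nat"
  defines "k \<equiv> nested_k q e"
    and "alg \<equiv> nested_binary_additive r l m\<^sub>0 q e"
  defines "T \<equiv> {k (j - 1) * 2 ^ i | i j. j \<in> {1..q} \<and> i < e (q + 1 - j)}"
  assumes "simple_cf c \<alpha> \<and> quadratic_irrational \<rat> \<alpha> \<or>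
           gaussian_cf c \<alpha> \<and> quadratic_irrational gaussian_rationals \<alpha>"
    and "l \<ge> 1"
    and "\<And>i. i > 0 \<Longrightarrow> c (r + i) = c (r + i + l)"
    and "m \<ge> r + l"
    and "m\<^sub>0 = r + ((m - r) mod l)"
    and "m = m\<^sub>0 + l * h"
    and "q \<ge> 1"
    and "h = nested_binary (map e [1..<q + 1])"
    and "\<And>i. 1 < i \<Longrightarrow> i \<le> q \<Longrightarrow> e i > 0"
  shows "result ((\<lambda>j. Some (cf_trace c r l j)) |` T) alg
           [Psi (r + l) \<mapsto> conv_mat c (r + l), Psi r \<mapsto> conv_mat c r, Psi m\<^sub>0 \<mapsto> conv_mat c m\<^sub>0]
           (Psi m) = Some (conv_mat c m)
       \<and> mults alg = (if m\<^sub>0 = r then q else q + 2)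
       \<and> lincombs alg = (\<Sum>i=1..q. e i)
       \<and> coeff_indices alg = T"
proof -
  let ?s = "[Psi (r + l) \<mapsto> conv_mat c (r + l), Psi r \<mapsto> conv_mat c r, Psi m\<^sub>0 \<mapsto> conv_mat c m\<^sub>0]"
  have "nested_k q e j * 2 ^ i \<in> T" if "j < q" "i < e (q - j)" for i j
    unfolding T_def k_def using that by (intro CollectI exI[of _ i] exI[of _ "Suc j"]) auto
  then have "((\<lambda>j. Some (cf_trace c r l j)) |` T) (nested_k q e j * 2 ^ i) =
      Some (cf_trace c r l (nested_k q e j * 2 ^ i))" if "j < q" "i < e (q - j)" for i j
    using that by simp
  \<comment> \<open>The inputs may coincide, as for \<open>m\<^sub>0 = r\<close>; by
    \<open>stored_update\<close> this does no harm.\<close>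
  moreover have "stored c ?s r" "stored c ?s (r + l)" "stored c ?s m\<^sub>0"
    by (simp_all add: stored_update)
  moreover have "m\<^sub>0 \<ge> r"
    using assms(8) by simp
  ultimately have "result ((\<lambda>j. Some (cf_trace c r l j)) |` T) alg ?s (Psi m) =
      Some (conv_mat c m)"
    unfolding alg_def
    by (intro result_nested_binary_additive) (use assms(6,9,10,11) in auto)
  then show ?thesis
    using mults_nested_binary_additive[OF \<open>q \<ge> 1\<close>] lincombs_nested_binary_additive
      coeff_indices_nested_binary_additive
    unfolding alg_def T_def k_def by simp
qed

end
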